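(* Let $(M^n,g)$, $n\ge 4$, be a Riemannian manifold with PIC0. Then $2P<R$ at every point of $M$.
   Context: $R$ is the scalar curvature and $R_{ijkl}$ the curvature tensor, with the convention that $R_{ijij}$ (for orthonormal $e_i,e_j$) is the sectional curvature of the plane spanned by $e_i,e_j$. $(M,g)$ has PIC0 if for every $p\in M$ and every orthonormal 3-frame $\{e_i,e_j,e_k\}$ of $T_pM$ one has $R_{ikik}+R_{jkjk}>0$. The function $P$ is $P(x)=\sup_{h\neq0}\frac{R_{ijkl}(x)h^{ik}h^{jl}}{h_{ik}h^{ik}}$, the supremum over nonzero symmetric 2-tensors $h$ at $x$. *)

theory Defs
  imports "HOL-Analysis.Analysis"
begin

section \<open>Smooth functions on open subsets of coordinate space\<close>

definition pd :: "'n \<Rightarrow> (real^'n::finite \<Rightarrow> 'b::real_normed_vector) \<Rightarrow> real^'n \<Rightarrow> 'b" where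
  "pd i f x = frechet_derivative f (at x) (axis i 1)"

text \<open>To be used for open \<open>S\<close> only: derivatives at points of \<open>S\<close> are two-sided.\<close>

primrec Ck_on :: "nat \<Rightarrow> (real^'n::finite) set \<Rightarrow> (real^'n \<Rightarrow> 'b::real_normed_vector) \<Rightarrow> bool" where
  "Ck_on 0 S f \<longleftrightarrow> continuous_on S f"
| "Ck_on (Suc k) S f \<longleftrightarrow> (\<forall>x\<in>S. f differentiable (at x)) \<and> (\<forall>i. Ck_on k S (pd i f))"

definition smooth_on :: "(real^'n::finite) set \<Rightarrow> (real^'n \<Rightarrow> 'b::real_normed_vector) \<Rightarrow> bool" where
  "smooth_on S f \<longleftrightarrow> (\<forall>k. Ck_on k S f)"


section \<open>Smooth manifolds\<close>

text \<open>A chart is a pair of its domain and its coordinate map; the values of the coordinate map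
  outside the domain are irrelevant.\<close>

type_synonym ('a, 'n) chart = "'a set \<times> ('a \<Rightarrow> real^'n)"

definition is_chart :: "'a topology \<Rightarrow> ('a, 'n::finite) chart \<Rightarrow> bool" where
  "is_chart M c \<longleftrightarrow> openin M (fst c) \<and> open (snd c ` fst c) \<and>
     homeomorphic_map (subtopology M (fst c)) (top_of_set (snd c ` fst c)) (snd c)"

definition overlap :: "('a, 'n::finite) chart \<Rightarrow> ('a, 'n) chart \<Rightarrow> (real^'n) set" where
  "overlap c d = snd c ` (fst c \<inter> fst d)"

definition transition :: "('a, 'n::finite) chart \<Rightarrow> ('a, 'n) chart \<Rightarrow> real^'n \<Rightarrow> real^'n" where
  "transition c d = snd d \<circ> inv_into (fst c) (snd c)"

definition smooth_manifold :: "'a topology \<Rightarrow> ('a, 'n::finite) chart set \<Rightarrow> bool" where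
  "smooth_manifold M A \<longleftrightarrow>
     Hausdorff_space M \<and> second_countable M \<and>
     (\<forall>c\<in>A. is_chart M c) \<and> (\<Union>c\<in>A. fst c) = topspace M \<and>
     (\<forall>c\<in>A. \<forall>d\<in>A. smooth_on (overlap c d) (transition c d))"


section \<open>Riemannian metrics\<close>

text \<open>A metric is given by its coordinate matrices: \<open>g c x $ i $ j\<close> is the value of
  \<open>g (\<partial>\<^sub>i, \<partial>\<^sub>j)\<close> in the chart \<open>c\<close>, at the point with coordinates \<open>x\<close>. The last
  clause below is the transformation law of a covariant 2-tensor.\<close>

definition metric_inner :: "(real^'n \<Rightarrow> real^'n^'n) \<Rightarrow> real^'n::finite \<Rightarrow> real^'n \<Rightarrow> real^'n \<Rightarrow> real" where
  "metric_inner G x u v = (\<Sum>i\<in>UNIV. \<Sum>j\<in>UNIV. G x $ i $ j * u $ i * v $ j)"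

definition riemannian_metric ::
  "('a, 'n::finite) chart set \<Rightarrow> (('a, 'n) chart \<Rightarrow> real^'n \<Rightarrow> real^'n^'n) \<Rightarrow> bool" where
  "riemannian_metric A g \<longleftrightarrow>
     (\<forall>c\<in>A.
        (\<forall>i j. smooth_on (snd c ` fst c) (\<lambda>x. g c x $ i $ j)) \<and>
        (\<forall>x\<in>snd c ` fst c.
           (\<forall>i j. g c x $ i $ j = g c x $ j $ i) \<and>
           (\<forall>v. v \<noteq> 0 \<longrightarrow> 0 < metric_inner (g c) x v v))) \<and>
     (\<forall>c\<in>A. \<forall>d\<in>A. \<forall>x\<in>overlap c d. \<forall>u v.
        metric_inner (g c) x u v =
        metric_inner (g d) (transition c d x)
          (frechet_derivative (transition c d) (at x) u)
          (frechet_derivative (transition c d) (at x) v))"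

definition riemannian_manifold ::
  "'a topology \<Rightarrow> ('a, 'n::finite) chart set \<Rightarrow> (('a, 'n) chart \<Rightarrow> real^'n \<Rightarrow> real^'n^'n) \<Rightarrow> bool" where
  "riemannian_manifold M A g \<longleftrightarrow> smooth_manifold M A \<and> riemannian_metric A g"


section \<open>Curvature in a chart\<close>

text \<open>In this section \<open>G\<close> is the coordinate matrix of the metric in one chart and \<open>x\<close> the
  coordinates of a point.\<close>

definition metric_inv :: "(real^'n \<Rightarrow> real^'n^'n) \<Rightarrow> real^'n::finite \<Rightarrow> real^'n^'n" where
  "metric_inv G x = matrix_inv (G x)"

text \<open>The Levi-Civita connection: the covariant derivative of \<open>\<partial>\<^sub>j\<close> in direction \<open>\<partial>\<^sub>i\<close> is
  the sum over \<open>k\<close> of \<open>christoffel G k i j x\<close> times \<open>\<partial>\<^sub>k\<close>.\<close>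

definition christoffel :: "(real^'n \<Rightarrow> real^'n^'n) \<Rightarrow> 'n \<Rightarrow> 'n \<Rightarrow> 'n \<Rightarrow> real^'n::finite \<Rightarrow> real" where
  "christoffel G k i j x = (1/2) * (\<Sum>m\<in>UNIV. metric_inv G x $ k $ m *
     (pd i (\<lambda>y. G y $ j $ m) x + pd j (\<lambda>y. G y $ i $ m) x - pd m (\<lambda>y. G y $ i $ j) x))"

text \<open>With \<open>R(X,Y)Z = \<nabla>\<^sub>X \<nabla>\<^sub>Y Z - \<nabla>\<^sub>Y \<nabla>\<^sub>X Z - \<nabla>\<^bsub>[X,Y]\<^esub> Z\<close>, this is the \<open>\<partial>\<^sub>l\<close>
  component of \<open>R(\<partial>\<^sub>i,\<partial>\<^sub>j)\<partial>\<^sub>k\<close>.\<close>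

definition curv_endo ::
  "(real^'n \<Rightarrow> real^'n^'n) \<Rightarrow> real^'n::finite \<Rightarrow> 'n \<Rightarrow> 'n \<Rightarrow> 'n \<Rightarrow> 'n \<Rightarrow> real" where
  "curv_endo G x i j k l =
     pd i (christoffel G l j k) x - pd j (christoffel G l i k) x +
     (\<Sum>m\<in>UNIV. christoffel G l i m x * christoffel G m j k x -
                   christoffel G l j m x * christoffel G m i k x)"

text \<open>The curvature tensor \<open>R\<^sub>i\<^sub>j\<^sub>k\<^sub>l = g(R(\<partial>\<^sub>i,\<partial>\<^sub>j)\<partial>\<^sub>l, \<partial>\<^sub>k)\<close>. The order of the last two
  indices makes \<open>R(u,v,u,v) = g(R(u,v)v, u)\<close> the sectional curvature of the plane spanned by
  orthonormal \<open>u\<close>, \<open>v\<close> (positive on round spheres).\<close>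

definition riem ::
  "(real^'n \<Rightarrow> real^'n^'n) \<Rightarrow> real^'n::finite \<Rightarrow> 'n \<Rightarrow> 'n \<Rightarrow> 'n \<Rightarrow> 'n \<Rightarrow> real" where
  "riem G x i j k l = (\<Sum>m\<in>UNIV. G x $ k $ m * curv_endo G x i j l m)"

definition riem_vec ::
  "(real^'n \<Rightarrow> real^'n^'n) \<Rightarrow> real^'n::finite \<Rightarrow> real^'n \<Rightarrow> real^'n \<Rightarrow> real^'n \<Rightarrow> real^'n \<Rightarrow> real" where
  "riem_vec G x u v w z =
     (\<Sum>i\<in>UNIV. \<Sum>j\<in>UNIV. \<Sum>k\<in>UNIV. \<Sum>l\<in>UNIV. riem G x i j k l * u $ i * v $ j * w $ k * z $ l)"

definition scalar_curv :: "(real^'n \<Rightarrow> real^'n^'n) \<Rightarrow> real^'n::finite \<Rightarrow> real" where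
  "scalar_curv G x =
     (\<Sum>i\<in>UNIV. \<Sum>j\<in>UNIV. \<Sum>k\<in>UNIV. \<Sum>l\<in>UNIV.
        metric_inv G x $ i $ k * metric_inv G x $ j $ l * riem G x i j k l)"

definition raise :: "(real^'n \<Rightarrow> real^'n^'n) \<Rightarrow> real^'n::finite \<Rightarrow> real^'n^'n \<Rightarrow> real^'n^'n" where
  "raise G x h = (\<chi> i k. \<Sum>a\<in>UNIV. \<Sum>b\<in>UNIV. metric_inv G x $ i $ a * metric_inv G x $ k $ b * h $ a $ b)"

text \<open>The quotient is continuous and homogeneous of degree 0 in \<open>h\<close>, hence bounded, so the
  supremum is a genuine real supremum.\<close>

definition curv_sup :: "(real^'n \<Rightarrow> real^'n^'n) \<Rightarrow> real^'n::finite \<Rightarrow> real" where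
  "curv_sup G x = (SUP h \<in> {h. transpose h = h \<and> h \<noteq> 0}.
     (\<Sum>i\<in>UNIV. \<Sum>j\<in>UNIV. \<Sum>k\<in>UNIV. \<Sum>l\<in>UNIV.
        riem G x i j k l * raise G x h $ i $ k * raise G x h $ j $ l) /
     (\<Sum>i\<in>UNIV. \<Sum>k\<in>UNIV. h $ i $ k * raise G x h $ i $ k))"


section \<open>PIC0\<close>

definition orthonormal3 ::
  "(real^'n \<Rightarrow> real^'n^'n) \<Rightarrow> real^'n::finite \<Rightarrow> real^'n \<Rightarrow> real^'n \<Rightarrow> real^'n \<Rightarrow> bool" where
  "orthonormal3 G x u v w \<longleftrightarrow>
     metric_inner G x u u = 1 \<and> metric_inner G x v v = 1 \<and> metric_inner G x w w = 1 \<and>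
     metric_inner G x u v = 0 \<and> metric_inner G x u w = 0 \<and> metric_inner G x v w = 0"

text \<open>Tangent vectors at \<open>p\<close> are represented by their components in a chart \<open>c\<close> around \<open>p\<close>.
  As curvature is a tensor, the condition at \<open>p\<close> does not depend on the choice of \<open>c\<close>.\<close>

definition PIC0 ::
  "'a topology \<Rightarrow> ('a, 'n::finite) chart set \<Rightarrow> (('a, 'n) chart \<Rightarrow> real^'n \<Rightarrow> real^'n^'n) \<Rightarrow> bool" where
  "PIC0 M A g \<longleftrightarrow>
     (\<forall>p\<in>topspace M. \<forall>c\<in>A. p \<in> fst c \<longrightarrow>
        (\<forall>u v w. orthonormal3 (g c) (snd c p) u v w \<longrightarrow>
           riem_vec (g c) (snd c p) u w u w + riem_vec (g c) (snd c p) v w v w > 0))"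

end

theory Submission
  imports Defs
begin

text \<open>
  At a point, choose an orthonormal frame \<open>e\<close> diagonalizing \<open>h\<close>, with eigenvalues \<open>l\<close>, and let
  \<open>K a b\<close> be the sectional curvature of the plane spanned by \<open>e a\<close> and \<open>e b\<close>. With
  \<open>q a b = |l|\<^sup>2 - 2 (l a) (l b)\<close> the claim becomes that the sum of \<open>K a b * q a b\<close> over
  \<open>a \<noteq> b\<close> is positive. Now \<open>q\<close> satisfies a triangle inequality:
  \<open>q a c + q b c - q a b\<close> equals \<open>(l a + l b - l c)\<^sup>2\<close> plus the sum of \<open>(l d)\<^sup>2\<close> over the
  remaining indices \<open>d\<close>. Summing \<open>(K a c + K b c) * (q a c + q b c - q a b)\<close> over all ordered
  triples of distinct indices, the mixed terms cancel by symmetry and \<open>2 (n - 2)\<close> times the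
  desired sum remains. PIC0 makes every first factor positive, and \<open>n \<ge> 4\<close> makes some second
  factor positive. As the supremum over \<open>h\<close> is attained, the strict inequality survives.

  The symmetry of \<open>K\<close> comes from the antisymmetry of the curvature tensor in its last two indices,
  which rests on metric compatibility and the symmetry of second derivatives.
\<close>

section \<open>Partial derivatives\<close>

lemma has_derivative_pd_line:
  assumes "f differentiable (at (x + t *\<^sub>R axis i 1))"
  shows "((\<lambda>s. f (x + s *\<^sub>R axis i 1)) has_derivative (\<lambda>s. s *\<^sub>R pd i f (x + t *\<^sub>R axis i 1))) (at t)"
proof -
  have f: "(f has_derivative frechet_derivative f (at (x + t *\<^sub>R axis i 1))) (at (x + t *\<^sub>R axis i 1))"
    using assms by (simp add: frechet_derivative_works)
  have "((\<lambda>s. x + s *\<^sub>R axis i 1) has_derivative (\<lambda>s::real. s *\<^sub>R axis i 1)) (at t)"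
    by (auto intro!: derivative_eq_intros)
  from has_derivative_compose[OF this f] show ?thesis
    using linear_frechet_derivative[OF assms] by (simp add: pd_def linear_scale)
qed

text \<open>The one-variable mean value theorem along a coordinate line. Differentiability at both
  end points supplies continuity on the closed interval.\<close>

lemma pd_mean_value:
  fixes f :: "real^'n::finite \<Rightarrow> real"
  assumes "h > 0" and "\<And>t. 0 \<le> t \<Longrightarrow> t \<le> h \<Longrightarrow> f differentiable (at (x + t *\<^sub>R axis i 1))"
  obtains t where "0 < t" "t < h" "f (x + h *\<^sub>R axis i 1) - f x = h * pd i f (x + t *\<^sub>R axis i 1)"
proof -
  let ?\<phi> = "\<lambda>s. f (x + s *\<^sub>R axis i 1)"
  have der: "(?\<phi> has_derivative (\<lambda>s. s *\<^sub>R pd i f (x + t *\<^sub>R axis i 1))) (at t)"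
    if "0 \<le> t" "t \<le> h" for t
    using has_derivative_pd_line assms(2) that by blast
  have "continuous_on {0..h} ?\<phi>"
    using der by (meson atLeastAtMost_iff continuous_at_imp_continuous_on has_derivative_continuous)
  then obtain t where "0 < t" "t < h" "?\<phi> h - ?\<phi> 0 = (h - 0) *\<^sub>R pd i f (x + t *\<^sub>R axis i 1)"
    using mvt[of 0 h ?\<phi> "\<lambda>t s. s *\<^sub>R pd i f (x + t *\<^sub>R axis i 1)"] der assms(1)
    by (metis less_eq_real_def)
  then show thesis
    using that by simp
qed

lemma pd_eqI:
  assumes "(f has_derivative f') (at x)"
  shows "pd i f x = f' (axis i 1)"
  using frechet_derivative_at[OF assms] by (simp add: pd_def)

lemma has_derivative_frechet:
  "f differentiable F \<Longrightarrow> (f has_derivative frechet_derivative f F) F"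
  by (simp add: frechet_derivative_works)

lemma pd_transform:
  assumes "f differentiable (at x)" "open S" "x \<in> S" "\<And>y. y \<in> S \<Longrightarrow> f y = g y"
  shows "pd i f x = pd i g x"
  using frechet_derivative_transform_within_open[OF assms] by (simp add: pd_def)

lemma pd_add:
  assumes "f differentiable (at x)" "g differentiable (at x)"
  shows "pd i (\<lambda>y. f y + g y) x = pd i f x + pd i g x"
  using pd_eqI[OF has_derivative_add[OF has_derivative_frechet[OF assms(1)] has_derivative_frechet[OF assms(2)]]]
  by (simp add: pd_def)

lemma pd_mult:
  fixes f g :: "real^'n::finite \<Rightarrow> real"
  assumes "f differentiable (at x)" "g differentiable (at x)"
  shows "pd i (\<lambda>y. f y * g y) x = f x * pd i g x + pd i f x * g x"
  using pd_eqI[OF has_derivative_mult[OF has_derivative_frechet[OF assms(1)] has_derivative_frechet[OF assms(2)]]]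
  by (simp add: pd_def)

lemma pd_sum:
  assumes "\<And>m. m \<in> I \<Longrightarrow> f m differentiable (at x)"
  shows "pd i (\<lambda>y. \<Sum>m\<in>I. f m y) x = (\<Sum>m\<in>I. pd i (f m) x)"
proof -
  have "((\<lambda>y. \<Sum>m\<in>I. f m y) has_derivative (\<lambda>v. \<Sum>m\<in>I. frechet_derivative (f m) (at x) v)) (at x)"
    using assms by (intro has_derivative_sum has_derivative_frechet)
  from pd_eqI[OF this] show ?thesis by (simp add: pd_def)
qed

section \<open>Symmetry of second derivatives\<close>

text \<open>Two mean value steps: one for the increment of \<open>f\<close> by \<open>h\<close> in
  direction \<open>j\<close>, taken along direction \<open>i\<close>, and one for
  \<open>pd i f\<close> along direction \<open>j\<close>. The closed square inside \<open>S\<close>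
  contains every point that is visited.\<close>

lemma second_difference_eq_pd:
  fixes f :: "real^'n::finite \<Rightarrow> real"
  assumes "Ck_on 2 S f" and "h > 0"
    and S: "\<And>s t. 0 \<le> s \<Longrightarrow> s \<le> h \<Longrightarrow> 0 \<le> t \<Longrightarrow> t \<le> h \<Longrightarrow> x + s *\<^sub>R axis i 1 + t *\<^sub>R axis j 1 \<in> S"
  obtains s t where "0 < s" "s < h" "0 < t" "t < h"
    "f (x + h *\<^sub>R axis i 1 + h *\<^sub>R axis j 1) - f (x + h *\<^sub>R axis i 1) - f (x + h *\<^sub>R axis j 1) + f x
      = h * h * pd j (pd i f) (x + s *\<^sub>R axis i 1 + t *\<^sub>R axis j 1)"
proof -
  have df: "\<And>y. y \<in> S \<Longrightarrow> f differentiable (at y)" and dpf: "\<And>y. y \<in> S \<Longrightarrow> pd i f differentiable (at y)"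
    using assms(1) by (auto simp: numeral_2_eq_2)
  let ?v = "h *\<^sub>R axis j 1 :: real^'n"
  let ?F = "\<lambda>y. f (y + ?v) - f y"
  have F: "(?F has_derivative (\<lambda>w. frechet_derivative f (at (y + ?v)) w - frechet_derivative f (at y) w)) (at y)"
    if "y \<in> S" "y + ?v \<in> S" for y
  proof -
    have "((\<lambda>y. f (y + ?v)) has_derivative frechet_derivative f (at (y + ?v))) (at y)"
      by (rule has_derivative_compose[of "\<lambda>y. y + ?v" "\<lambda>w. w" y UNIV f])
        (auto intro!: derivative_eq_intros has_derivative_frechet df that)
    then show ?thesis
      by (intro has_derivative_diff has_derivative_frechet df that)
  qed
  have in_S: "x + s *\<^sub>R axis i 1 \<in> S" "x + s *\<^sub>R axis i 1 + ?v \<in> S" if "0 \<le> s" "s \<le> h" for s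
    using S[of s 0] S[of s h] that \<open>h > 0\<close> by simp_all
  obtain s where s: "0 < s" "s < h" and Fs: "?F (x + h *\<^sub>R axis i 1) - ?F x = h * pd i ?F (x + s *\<^sub>R axis i 1)"
    using pd_mean_value[of h ?F x i] F in_S \<open>h > 0\<close> by (metis (no_types, lifting) differentiableI)
  let ?y = "x + s *\<^sub>R axis i 1"
  have pF: "pd i ?F ?y = pd i f (?y + ?v) - pd i f ?y"
    using pd_eqI[OF F[of ?y]] in_S[of s] s by (simp add: pd_def)
  have "pd i f differentiable (at (?y + t *\<^sub>R axis j 1))" if "0 \<le> t" "t \<le> h" for t
    using dpf S[of s t] s that by simp
  from pd_mean_value[OF \<open>h > 0\<close> this]
  obtain t where t: "0 < t" "t < h" and "pd i f (?y + ?v) - pd i f ?y = h * pd j (pd i f) (?y + t *\<^sub>R axis j 1)"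
    by blast
  with Fs pF have "?F (x + h *\<^sub>R axis i 1) - ?F x = h * h * pd j (pd i f) (?y + t *\<^sub>R axis j 1)"
    by simp
  then show thesis
    using that[OF s t] by (simp add: algebra_simps)
qed

text \<open>The second difference over a small square is symmetric in the two directions, so each
  mixed derivative takes the same value somewhere in the square. Continuity carries this over to
  \<open>x\<close>.\<close>

lemma pd_commute:
  fixes f :: "real^'n::finite \<Rightarrow> real"
  assumes "open S" "x \<in> S" "Ck_on 2 S f"
  shows "pd i (pd j f) x = pd j (pd i f) x"
proof (rule dense_eq0_I[of "_ - _", THEN eq_iff_diff_eq_0[THEN iffD2]])
  fix e :: real assume "e > 0"
  have cont: "continuous_on S (pd a (pd b f))" for a b
    using assms(3) by (simp add: numeral_2_eq_2)
  have near: "\<exists>d>0. \<forall>y. dist y x < d \<longrightarrow> y \<in> S \<and> dist (pd a (pd b f) y) (pd a (pd b f) x) < e / 2" for a b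
  proof -
    obtain d1 where "d1 > 0" "\<forall>y. dist y x < d1 \<longrightarrow> y \<in> S"
      using assms(1,2) open_dist by blast
    moreover obtain d2 where "d2 > 0" "\<forall>y\<in>S. dist y x < d2 \<longrightarrow> dist (pd a (pd b f) y) (pd a (pd b f) x) < e / 2"
      using cont[of a b] assms(2) \<open>e > 0\<close> unfolding continuous_on_iff by (meson half_gt_zero)
    ultimately show ?thesis
      by (intro exI[of _ "min d1 d2"]) auto
  qed
  obtain d1 where d1: "d1 > 0" "\<And>y. dist y x < d1 \<Longrightarrow> y \<in> S \<and> dist (pd i (pd j f) y) (pd i (pd j f) x) < e / 2"
    using near[of i j] by blast
  obtain d2 where d2: "d2 > 0" "\<And>y. dist y x < d2 \<Longrightarrow> y \<in> S \<and> dist (pd j (pd i f) y) (pd j (pd i f) x) < e / 2"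
    using near[of j i] by blast
  \<comment> \<open>Points of the square of side \<open>h\<close> lie within \<open>2 * h\<close> of
    \<open>x\<close>; a third of the smaller radius keeps \<open>2 * h\<close> strictly below both
    radii.\<close>
  define h where "h = min d1 d2 / 3"
  have h: "h > 0" "2 * h < d1" "2 * h < d2"
    using d1 d2 by (auto simp: h_def)
  have dist: "dist (x + s *\<^sub>R axis a 1 + t *\<^sub>R axis b 1) x \<le> 2 * h"
    if "0 \<le> s" "s \<le> h" "0 \<le> t" "t \<le> h" for s t and a b :: 'n
  proof -
    have "dist (x + s *\<^sub>R axis a 1 + t *\<^sub>R axis b 1) x \<le> norm (s *\<^sub>R axis a 1 :: real^'n) + norm (t *\<^sub>R axis b 1 :: real^'n)"
      using norm_triangle_ineq[of "s *\<^sub>R axis a 1 :: real^'n" "t *\<^sub>R axis b 1"] by (simp add: dist_norm add.assoc)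
    then show ?thesis using that by simp
  qed
  have in_S: "x + s *\<^sub>R axis a 1 + t *\<^sub>R axis b 1 \<in> S"
    if "0 \<le> s" "s \<le> h" "0 \<le> t" "t \<le> h" for s t and a b :: 'n
    using dist[OF that, of a b] d1(2) h by force
  let ?D = "f (x + h *\<^sub>R axis i 1 + h *\<^sub>R axis j 1) - f (x + h *\<^sub>R axis i 1) - f (x + h *\<^sub>R axis j 1) + f x"
  obtain s t where st: "0 < s" "s < h" "0 < t" "t < h" "?D = h * h * pd j (pd i f) (x + s *\<^sub>R axis i 1 + t *\<^sub>R axis j 1)"
    by (rule second_difference_eq_pd[OF assms(3) h(1), of x i j]) (use in_S in blast)+
  \<comment> \<open>Exchanging the directions leaves the second difference unchanged; this is the
    source of the symmetry.\<close>
  have "f (x + h *\<^sub>R axis j 1 + h *\<^sub>R axis i 1) - f (x + h *\<^sub>R axis j 1) - f (x + h *\<^sub>R axis i 1) + f x = ?D"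
    by (simp add: algebra_simps)
  then obtain s' t' where st': "0 < s'" "s' < h" "0 < t'" "t' < h" "?D = h * h * pd i (pd j f) (x + s' *\<^sub>R axis j 1 + t' *\<^sub>R axis i 1)"
    using second_difference_eq_pd[OF assms(3) h(1), of x j i] in_S by (smt (verit))
  have eq: "pd j (pd i f) (x + s *\<^sub>R axis i 1 + t *\<^sub>R axis j 1) = pd i (pd j f) (x + s' *\<^sub>R axis j 1 + t' *\<^sub>R axis i 1)"
    using st(5) st'(5) h(1) by simp
  have "dist (pd j (pd i f) (x + s *\<^sub>R axis i 1 + t *\<^sub>R axis j 1)) (pd j (pd i f) x) < e / 2"
    using d2(2) dist[of s t i j] st h by force
  moreover have "dist (pd i (pd j f) (x + s' *\<^sub>R axis j 1 + t' *\<^sub>R axis i 1)) (pd i (pd j f) x) < e / 2"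
    using d1(2) dist[of s' t' j i] st' h by force
  ultimately show "\<bar>pd i (pd j f) x - pd j (pd i f) x\<bar> \<le> e"
    unfolding eq dist_real_def by linarith
qed

section \<open>Simultaneous diagonalization\<close>

text \<open>Written with the inner product so that \<open>A\<close>-orthogonality to
  \<open>e\<close> becomes Euclidean orthogonality to \<open>A *v e\<close>;
  \<open>bform_eq_sum\<close> gives back the double sum of \<open>metric_inner\<close>.\<close>

definition bform :: "real^'n^'n \<Rightarrow> real^'n::finite \<Rightarrow> real^'n \<Rightarrow> real" where
  "bform A u v = u \<bullet> (A *v v)"

lemma bform_eq_sum: "bform A u v = (\<Sum>i\<in>UNIV. \<Sum>j\<in>UNIV. A $ i $ j * u $ i * v $ j)"
  by (simp add: bform_def inner_vec_def matrix_vector_mult_def sum_distrib_left mult_ac)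

lemma bform_add: "bform A (u + v) w = bform A u w + bform A v w"
    "bform A u (v + w) = bform A u v + bform A u w"
  and bform_scaleR: "bform A (c *\<^sub>R u) v = c * bform A u v" "bform A u (c *\<^sub>R v) = c * bform A u v"
  by (simp_all add: bform_def inner_add matrix_vector_right_distrib matrix_vector_mult_scaleR)

lemma bform_commute:
  assumes "transpose A = A"
  shows "bform A u v = bform A v u"
  unfolding bform_def by (metis assms dot_lmul_matrix inner_commute transpose_matrix_vector)

lemma continuous_on_bform: "continuous_on T (\<lambda>v. bform A v v)"
  unfolding bform_def by (intro continuous_intros)

text \<open>For small \<open>t\<close> the linear term would dominate and could be made positive. It
  expresses the vanishing of the first variation at a maximum.\<close>

lemma linear_coeff_zero:
  fixes a b :: real
  assumes "\<And>t. 2 * t * a + t\<^sup>2 * b \<le> 0"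
  shows "a = 0"
proof -
  have "2 * t * a + t\<^sup>2 * \<bar>b\<bar> \<le> 2 * t\<^sup>2 * \<bar>b\<bar>" for t
  proof -
    have "t\<^sup>2 * (\<bar>b\<bar> - b) \<le> t\<^sup>2 * (2 * \<bar>b\<bar>)" by (intro mult_left_mono) auto
    then show ?thesis using assms[of t] by (simp add: algebra_simps)
  qed
  \<comment> \<open>This \<open>t\<close> has the sign of \<open>a\<close>, and the added 1 keeps
    the denominator positive when \<open>b = 0\<close>.\<close>
  from this[of "a / (\<bar>b\<bar> + 1)"]
  have "2 * (a / (\<bar>b\<bar> + 1)) * a \<le> (a / (\<bar>b\<bar> + 1))\<^sup>2 * \<bar>b\<bar>" by (simp add: mult.commute)
  then have "2 * a\<^sup>2 * (\<bar>b\<bar> + 1) \<le> a\<^sup>2 * \<bar>b\<bar>"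
    by (simp add: divide_simps power2_eq_square split: if_splits)
  then have "a\<^sup>2 * (\<bar>b\<bar> + 2) \<le> 0" by (simp add: algebra_simps)
  then show ?thesis
    by (auto simp: mult_le_0_iff)
qed

text \<open>The vector \<open>e\<close> maximizes the Rayleigh quotient of \<open>H\<close> against
  \<open>A\<close> on \<open>T\<close>. Its first variation vanishes in every direction of
  \<open>T\<close> that is \<open>A\<close>-orthogonal to \<open>e\<close>.\<close>

lemma bform_maximizer:
  fixes A H :: "real^'n^'n::finite"
  assumes sym: "transpose A = A" "transpose H = H"
    and pos: "\<And>v. v \<noteq> 0 \<Longrightarrow> bform A v v > 0"
    and T: "subspace T" "w \<in> T" "w \<noteq> 0"
  obtains e where "e \<in> T" "bform A e e = 1" "\<And>v. v \<in> T \<Longrightarrow> bform A v e = 0 \<Longrightarrow> bform H v e = 0"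
proof -
  \<comment> \<open>The quotient is homogeneous of degree 0, so the Euclidean unit sphere of
    \<open>T\<close>, which is compact, sees all its values.\<close>
  let ?K = "T \<inter> sphere 0 1" and ?q = "\<lambda>v. bform H v v / bform A v v"
  have "compact ?K"
    using closed_subspace[OF T(1)] by (simp add: closed_Int_compact)
  moreover have "w /\<^sub>R norm w \<in> ?K"
    using T by (simp add: subspace_scale)
  moreover have "continuous_on ?K ?q"
  proof (intro continuous_on_divide continuous_on_bform ballI)
    show "bform A v v \<noteq> 0" if "v \<in> ?K" for v
      using pos[of v] that by (metis IntE dist_0_norm less_irrefl mem_sphere norm_zero zero_neq_one)
  qed
  ultimately obtain u where u: "u \<in> ?K" and max: "\<And>v. v \<in> ?K \<Longrightarrow> ?q v \<le> ?q u"
    using continuous_attains_sup[of ?K ?q] by blast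
  have Au: "bform A u u > 0" using u pos[of u] by (metis IntE dist_0_norm mem_sphere norm_zero zero_neq_one)
  define e where "e = u /\<^sub>R sqrt (bform A u u)"
  have "bform A e e = 1" and He: "bform H e e = ?q u"
    using Au by (simp_all add: e_def bform_scaleR field_simps flip: real_sqrt_mult)
  have "e \<in> T" using u T by (simp add: e_def subspace_scale)
  have le: "bform H v v \<le> bform H e e * bform A v v" if "v \<in> T" for v
  proof (cases "v = 0")
    case False
    then have "v /\<^sub>R norm v \<in> ?K" using that T by (simp add: subspace_scale)
    from max[OF this] have "?q v \<le> ?q u" using False by (simp add: bform_scaleR)
    then show ?thesis using pos[OF False] He by (simp add: divide_le_eq)
  qed (simp add: bform_def)
  \<comment> \<open>The bound \<open>le\<close> at \<open>e + t *\<^sub>R v\<close> is quadratic in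
    \<open>t\<close> with no constant term, because \<open>e\<close> attains equality.\<close>
  have "bform H v e = 0" if "v \<in> T" "bform A v e = 0" for v
  proof (rule linear_coeff_zero)
    fix t :: real
    have "e + t *\<^sub>R v \<in> T" using T \<open>e \<in> T\<close> that by (simp add: subspace_add subspace_scale)
    from le[OF this]
    show "2 * t * bform H v e + t\<^sup>2 * (bform H v v - bform H e e * bform A v v) \<le> 0"
      using that(2) \<open>bform A e e = 1\<close> bform_commute[OF sym(1), of e v] bform_commute[OF sym(2), of e v]
      by (simp add: bform_add bform_scaleR algebra_simps power2_eq_square)
  qed
  then show thesis using that \<open>e \<in> T\<close> \<open>bform A e e = 1\<close> by blast
qed

text \<open>Induction on the number of frame vectors. The second conjunct is the invariant: whatever
  is \<open>A\<close>-orthogonal to all chosen vectors is also \<open>H\<close>-orthogonal to them,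
  so the next maximizer is automatically \<open>H\<close>-orthogonal to its predecessors.\<close>

lemma simultaneous_diagonalization_partial:
  fixes A H :: "real^'n^'n::finite"
  assumes sym: "transpose A = A" "transpose H = H"
    and pos: "\<And>v. v \<noteq> 0 \<Longrightarrow> bform A v v > 0"
    and "k \<le> CARD('n)"
  shows "\<exists>e :: nat \<Rightarrow> real^'n.
    (\<forall>i<k. \<forall>j<k. bform A (e i) (e j) = (if i = j then 1 else 0)) \<and>
    (\<forall>i<k. \<forall>v. (\<forall>j<k. bform A v (e j) = 0) \<longrightarrow> bform H v (e i) = 0) \<and>
    (\<forall>i<k. \<forall>j<k. i \<noteq> j \<longrightarrow> bform H (e i) (e j) = 0)"
  using \<open>k \<le> CARD('n)\<close>
proof (induction k)
  case (Suc k)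
  then obtain e :: "nat \<Rightarrow> real^'n" where
    IH: "\<forall>i<k. \<forall>j<k. bform A (e i) (e j) = (if i = j then 1 else 0)"
        "\<forall>i<k. \<forall>v. (\<forall>j<k. bform A v (e j) = 0) \<longrightarrow> bform H v (e i) = 0"
        "\<forall>i<k. \<forall>j<k. i \<noteq> j \<longrightarrow> bform H (e i) (e j) = 0"
    by auto
  let ?T = "{v. \<forall>j<k. bform A v (e j) = 0}"
  have T: "subspace ?T"
    by (auto simp: subspace_def bform_add bform_scaleR) (simp add: bform_def)
  \<comment> \<open>\<open>?T\<close> is the Euclidean orthogonal complement of \<open>?V\<close>.
    With \<open>k\<close> below the dimension, \<open>?V\<close> cannot span, so \<open>?T\<close>
    contains a nonzero vector.\<close>
  let ?V = "(\<lambda>j. A *v e j) ` {..<k}"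
  have "dim ?V < DIM(real^'n)"
    using dim_le_card'[of ?V] card_image_le[of "{..<k}" "\<lambda>j. A *v e j"] Suc.prems by simp
  then obtain w where "w \<noteq> 0" "\<And>y. y \<in> span ?V \<Longrightarrow> orthogonal w y"
    using orthogonal_to_subspace_exists by blast
  then have "w \<in> ?T" "w \<noteq> 0"
    by (auto simp: orthogonal_def bform_def span_base)
  then obtain u where u: "u \<in> ?T" "bform A u u = 1"
      and uH: "\<And>v. v \<in> ?T \<Longrightarrow> bform A v u = 0 \<Longrightarrow> bform H v u = 0"
    using bform_maximizer[OF sym pos T] by blast
  define e' where "e' = e(k := u)"
  have e': "e' k = u" "\<And>i. i < k \<Longrightarrow> e' i = e i" by (simp_all add: e'_def)
  have uA: "bform A (e i) u = 0" "bform A u (e i) = 0" and uH': "bform H (e i) u = 0" "bform H u (e i) = 0" if "i < k" for i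
    using u IH(2) that bform_commute[OF sym(1), of "e i" u] bform_commute[OF sym(2), of "e i" u] by auto
  have "\<forall>i<Suc k. \<forall>j<Suc k. bform A (e' i) (e' j) = (if i = j then 1 else 0)"
    using IH(1) u uA by (auto simp: less_Suc_eq e')
  moreover have "\<forall>i<Suc k. \<forall>v. (\<forall>j<Suc k. bform A v (e' j) = 0) \<longrightarrow> bform H v (e' i) = 0"
    using IH(2) uH by (auto simp: less_Suc_eq e' all_conj_distrib imp_conjR)
  moreover have "\<forall>i<Suc k. \<forall>j<Suc k. i \<noteq> j \<longrightarrow> bform H (e' i) (e' j) = 0"
    using IH(3) uH' by (auto simp: less_Suc_eq e')
  ultimately show ?case by blast
qed simp

lemma simultaneous_diagonalization:
  fixes A H :: "real^'n^'n::finite"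
  assumes sym: "transpose A = A" "transpose H = H"
    and pos: "\<And>v. v \<noteq> 0 \<Longrightarrow> bform A v v > 0"
  obtains e :: "'n \<Rightarrow> real^'n" and l :: "'n \<Rightarrow> real" where
    "\<And>a b. bform A (e a) (e b) = (if a = b then 1 else 0)"
    "\<And>a b. bform H (e a) (e b) = (if a = b then l a else 0)"
proof -
  obtain f :: "nat \<Rightarrow> real^'n" where
    f: "\<forall>i<CARD('n). \<forall>j<CARD('n). bform A (f i) (f j) = (if i = j then 1 else 0)"
       "\<forall>i<CARD('n). \<forall>j<CARD('n). i \<noteq> j \<longrightarrow> bform H (f i) (f j) = 0"
    using simultaneous_diagonalization_partial[OF sym pos order_refl] by metis
  \<comment> \<open>The induction needed ordered indices; a bijection moves the frame to the
    coordinate index type.\<close>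
  obtain r :: "'n \<Rightarrow> nat" where r: "bij_betw r UNIV {0..<CARD('n)}"
    using ex_bij_betw_finite_nat[of "UNIV :: 'n set"] by auto
  have "r a < CARD('n)" "(r a = r b) = (a = b)" for a b
    using r by (auto simp: bij_betw_def inj_on_def)
  then show thesis
    using that[of "f \<circ> r" "\<lambda>a. bform H (f (r a)) (f (r a))"] f by auto
qed

section \<open>Symmetries of the curvature tensor\<close>

lemma matrix_inv_eqI:
  fixes A B :: "real^'n^'n::finite"
  assumes "A ** B = mat 1"
  shows "matrix_inv A = B"
proof -
  have "B ** A = mat 1" using assms matrix_left_right_inverse by blast
  then have "A ** matrix_inv A = mat 1 \<and> matrix_inv A ** A = mat 1"
    unfolding matrix_inv_def using assms by (intro someI[where P = "\<lambda>A'. A ** A' = mat 1 \<and> A' ** A = mat 1"]) simp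
  then show ?thesis
    by (metis \<open>B ** A = mat 1\<close> matrix_mul_assoc matrix_mul_lid matrix_mul_rid)
qed

lemma matrix_inv_mult:
  fixes A :: "real^'n^'n::finite"
  assumes "invertible A"
  shows "A ** matrix_inv A = mat 1" "matrix_inv A ** A = mat 1"
  using assms unfolding invertible_def by (metis matrix_inv_eqI)+

text \<open>Cramer's rule for column \<open>m\<close> of the inverse. It writes each entry as a
  quotient of determinants, from which differentiability can be read off.\<close>

lemma matrix_inv_component:
  fixes A :: "real^'n^'n::finite"
  assumes "invertible A"
  shows "matrix_inv A $ k $ m = det (\<chi> i j. if j = k then axis m 1 $ i else A $ i $ j) / det A"
proof -
  have "A *v (matrix_inv A *v axis m 1) = axis m 1"
    by (simp add: matrix_vector_mul_assoc matrix_inv_mult assms)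
  then have "matrix_inv A *v axis m 1 = (\<chi> k. det (\<chi> i j. if j = k then axis m 1 $ i else A $ i $ j) / det A)"
    using cramer assms invertible_det_nz by blast
  moreover have "(matrix_inv A *v axis m 1) $ k = matrix_inv A $ k $ m"
    by (simp add: matrix_vector_mult_def axis_def if_distrib cong: if_cong)
  ultimately show ?thesis by simp
qed

lemma differentiable_prod:
  fixes f :: "'i \<Rightarrow> 'a::real_normed_vector \<Rightarrow> real"
  assumes "finite I" "\<And>i. i \<in> I \<Longrightarrow> f i differentiable (at x)"
  shows "(\<lambda>y. \<Prod>i\<in>I. f i y) differentiable (at x)"
  using assms by (induction I rule: finite_induct) auto

lemma differentiable_det:
  fixes A :: "'a::real_normed_vector \<Rightarrow> real^'n^'n::finite"
  assumes "\<And>i j. (\<lambda>y. A y $ i $ j) differentiable (at x)"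
  shows "(\<lambda>y. det (A y)) differentiable (at x)"
  unfolding det_def
  by (intro differentiable_sum finite_permutations differentiable_mult differentiable_const
      differentiable_prod assms ballI) simp_all

lemma differentiable_transform_open:
  assumes "f differentiable (at x)" "open S" "x \<in> S" "\<And>y. y \<in> S \<Longrightarrow> f y = g y"
  shows "g differentiable (at x)"
  using assms has_derivative_transform_within_open unfolding differentiable_def by blast

lemma differentiable_metric_inv:
  fixes G :: "real^'n \<Rightarrow> real^'n^'n::finite"
  assumes "open S" "x \<in> S" "\<And>y. y \<in> S \<Longrightarrow> invertible (G y)"
    and "\<And>i j. (\<lambda>y. G y $ i $ j) differentiable (at x)"
  shows "(\<lambda>y. metric_inv G y $ k $ m) differentiable (at x)"
proof (rule differentiable_transform_open[OF _ assms(1,2)])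
  let ?B = "\<lambda>y. (\<chi> i j. if j = k then axis m 1 $ i else G y $ i $ j) :: real^'n^'n"
  have "(\<lambda>y. ?B y $ i $ j) differentiable (at x)" for i j
    using assms(4) by (cases "j = k") auto
  then show "(\<lambda>y. det (?B y) / det (G y)) differentiable (at x)"
    using assms by (intro differentiable_divide differentiable_det) (auto simp: invertible_det_nz)
qed (simp add: metric_inv_def matrix_inv_component assms(3))

section \<open>Christoffel symbols and the lowered curvature tensor\<close>

text \<open>Christoffel symbols of the first kind: the inner product of the covariant derivative of
  the \<open>j\<close>-th coordinate field in direction \<open>i\<close> with the
  \<open>k\<close>-th coordinate field.\<close>

definition christoffel_low :: "(real^'n \<Rightarrow> real^'n^'n) \<Rightarrow> 'n \<Rightarrow> 'n \<Rightarrow> 'n \<Rightarrow> real^'n::finite \<Rightarrow> real" where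
  "christoffel_low G k i j x = (1/2) *
     (pd i (\<lambda>y. G y $ j $ k) x + pd j (\<lambda>y. G y $ i $ k) x - pd k (\<lambda>y. G y $ i $ j) x)"

lemma christoffel_eq_low:
  "christoffel G k i j x = (\<Sum>m\<in>UNIV. metric_inv G x $ k $ m * christoffel_low G m i j x)"
  by (simp add: christoffel_def christoffel_low_def sum_distrib_left mult_ac)

lemma lower_christoffel:
  assumes "invertible (G x)"
  shows "(\<Sum>m\<in>UNIV. G x $ k $ m * christoffel G m i j x) = christoffel_low G k i j x"
proof -
  have "(\<Sum>m\<in>UNIV. G x $ k $ m * christoffel G m i j x) =
      (\<Sum>p\<in>UNIV. (G x ** metric_inv G x) $ k $ p * christoffel_low G p i j x)"
    unfolding christoffel_eq_low matrix_matrix_mult_def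
    by (simp add: sum_distrib_left sum_distrib_right mult_ac) (rule sum.swap)
  also have "\<dots> = christoffel_low G k i j x"
    by (simp add: metric_inv_def matrix_inv_mult assms mat_def if_distrib if_distribR cong: if_cong)
  finally show ?thesis .
qed

lemma metric_inner_eq_bform: "metric_inner G x u v = bform (G x) u v"
  by (simp add: metric_inner_def bform_eq_sum)

text \<open>The metric in one chart. Order 2 is what the curvature formula and the exchange of
  second derivatives call for.\<close>

locale local_metric =
  fixes G :: "real^'n \<Rightarrow> real^'n^'n::finite" and S :: "(real^'n) set"
  assumes open_S: "open S"
    and Ck2: "\<And>i j. Ck_on 2 S (\<lambda>y. G y $ i $ j)"
    and sym: "\<And>y i j. y \<in> S \<Longrightarrow> G y $ i $ j = G y $ j $ i"
    and pos: "\<And>y v. y \<in> S \<Longrightarrow> v \<noteq> 0 \<Longrightarrow> metric_inner G y v v > 0"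
begin

lemma bform_pos: "y \<in> S \<Longrightarrow> v \<noteq> 0 \<Longrightarrow> bform (G y) v v > 0"
  using pos by (simp add: metric_inner_eq_bform)

lemma transpose_G: "y \<in> S \<Longrightarrow> transpose (G y) = G y"
  by (simp add: vec_eq_iff transpose_def sym)

lemma inv: "y \<in> S \<Longrightarrow> invertible (G y)"
  using bform_pos by (auto simp: invertible_left_inverse matrix_left_invertible_ker bform_def) force

lemma differentiable_G: "y \<in> S \<Longrightarrow> (\<lambda>y. G y $ i $ j) differentiable (at y)"
  and differentiable_pd_G: "y \<in> S \<Longrightarrow> pd k (\<lambda>y. G y $ i $ j) differentiable (at y)"
  using Ck2 by (auto simp: numeral_2_eq_2)

lemma pd_G_sym: "y \<in> S \<Longrightarrow> pd k (\<lambda>y. G y $ i $ j) y = pd k (\<lambda>y. G y $ j $ i) y"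
  by (intro pd_transform[OF _ open_S] differentiable_G sym)

lemma differentiable_christoffel_low: "y \<in> S \<Longrightarrow> christoffel_low G k i j differentiable (at y)"
  unfolding christoffel_low_def[abs_def]
  by (intro differentiable_mult differentiable_add differentiable_diff differentiable_const differentiable_pd_G)

lemma differentiable_christoffel: "y \<in> S \<Longrightarrow> christoffel G k i j differentiable (at y)"
  unfolding christoffel_eq_low[abs_def]
  by (intro differentiable_sum differentiable_mult ballI finite differentiable_christoffel_low
      differentiable_metric_inv[OF open_S] inv differentiable_G)

text \<open>The Leibniz rule for the derivative of an inner product of coordinate fields. Two
  derivatives combine by the symmetry of \<open>G\<close>; the others cancel.\<close>

lemma metric_compatible:
  assumes "y \<in> S"
  shows "christoffel_low G k j l y + christoffel_low G l j k y = pd j (\<lambda>y. G y $ k $ l) y"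
  using pd_G_sym[OF assms, of j l k] pd_G_sym[OF assms, of l j k] pd_G_sym[OF assms, of k j l]
  unfolding christoffel_low_def by (simp add: field_simps)

text \<open>Both sides are the inner product of the covariant derivatives indexed \<open>i k\<close>
  and \<open>j l\<close>; only the factor with the lowered index differs.\<close>

lemma christoffel_low_pairing:
  assumes "y \<in> S"
  shows "(\<Sum>p\<in>UNIV. christoffel_low G p i k y * christoffel G p j l y) =
         (\<Sum>p\<in>UNIV. christoffel_low G p j l y * christoffel G p i k y)"
  unfolding lower_christoffel[of G, OF inv[OF assms], symmetric] sum_distrib_right
  by (subst sum.swap) (simp add: sym[OF assms] mult_ac)

text \<open>The product rule applied to \<open>lower_christoffel\<close>; the subtracted sum arises
  because lowering an index does not commute with \<open>pd\<close>.\<close>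

lemma lower_pd_christoffel:
  assumes "x \<in> S"
  shows "(\<Sum>m\<in>UNIV. G x $ k $ m * pd i (christoffel G m j l) x) =
    pd i (christoffel_low G k j l) x - (\<Sum>m\<in>UNIV. pd i (\<lambda>y. G y $ k $ m) x * christoffel G m j l x)"
proof -
  have "pd i (christoffel_low G k j l) x = pd i (\<lambda>y. \<Sum>m\<in>UNIV. G y $ k $ m * christoffel G m j l y) x"
    by (intro pd_transform[OF _ open_S assms] differentiable_christoffel_low assms lower_christoffel[symmetric] inv)
  also have "\<dots> = (\<Sum>m\<in>UNIV. pd i (\<lambda>y. G y $ k $ m * christoffel G m j l y) x)"
    by (intro pd_sum differentiable_mult differentiable_G differentiable_christoffel assms)
  also have "\<dots> = (\<Sum>m\<in>UNIV. G x $ k $ m * pd i (christoffel G m j l) x + pd i (\<lambda>y. G y $ k $ m) x * christoffel G m j l x)"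
    by (intro sum.cong refl pd_mult differentiable_G differentiable_christoffel assms)
  finally show ?thesis by (simp add: sum.distrib)
qed

text \<open>By \<open>metric_compatible\<close> each product rule correction splits in two: one half
  cancels a quadratic term of \<open>curv_endo\<close>, the other survives as an inner product of
  covariant derivatives. This form exposes the behaviour under exchange of \<open>k\<close> and
  \<open>l\<close>.\<close>

lemma riem_eq_low:
  assumes "x \<in> S"
  shows "riem G x i j k l =
    pd i (christoffel_low G k j l) x - pd j (christoffel_low G k i l) x
    - (\<Sum>p\<in>UNIV. christoffel_low G p i k x * christoffel G p j l x)
    + (\<Sum>p\<in>UNIV. christoffel_low G p j k x * christoffel G p i l x)"
proof -
  have quad: "(\<Sum>m\<in>UNIV. G x $ k $ m * (\<Sum>p\<in>UNIV. christoffel G m a p x * christoffel G p b l x)) =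
      (\<Sum>p\<in>UNIV. christoffel_low G k a p x * christoffel G p b l x)" for a b
    unfolding lower_christoffel[of G, OF inv[OF assms], symmetric] sum_distrib_right sum_distrib_left
    by (subst sum.swap) (simp add: mult_ac)
  have compat: "(\<Sum>m\<in>UNIV. pd a (\<lambda>y. G y $ k $ m) x * christoffel G m b l x) =
      (\<Sum>p\<in>UNIV. christoffel_low G k a p x * christoffel G p b l x) +
      (\<Sum>p\<in>UNIV. christoffel_low G p a k x * christoffel G p b l x)" for a b
    unfolding metric_compatible[OF assms, symmetric] by (simp add: distrib_right sum.distrib)
  have "riem G x i j k l =
     (\<Sum>m\<in>UNIV. G x $ k $ m * pd i (christoffel G m j l) x) -
     (\<Sum>m\<in>UNIV. G x $ k $ m * pd j (christoffel G m i l) x) +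
     ((\<Sum>m\<in>UNIV. G x $ k $ m * (\<Sum>p\<in>UNIV. christoffel G m i p x * christoffel G p j l x)) -
      (\<Sum>m\<in>UNIV. G x $ k $ m * (\<Sum>p\<in>UNIV. christoffel G m j p x * christoffel G p i l x)))"
    unfolding riem_def curv_endo_def
    by (simp add: sum.distrib sum_subtractf algebra_simps)
  then show ?thesis
    unfolding lower_pd_christoffel[OF assms] quad compat by simp
qed

text \<open>\<open>metric_compatible\<close> can be differentiated because it holds on the whole
  open set \<open>S\<close>.\<close>

lemma pd_christoffel_low_sym:
  assumes "x \<in> S"
  shows "pd i (christoffel_low G k j l) x + pd i (christoffel_low G l j k) x = pd i (pd j (\<lambda>y. G y $ k $ l)) x"
proof -
  have "pd i (\<lambda>y. christoffel_low G k j l y + christoffel_low G l j k y) x = pd i (pd j (\<lambda>y. G y $ k $ l)) x"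
    by (intro pd_transform[OF _ open_S assms] differentiable_add differentiable_christoffel_low
        metric_compatible assms)
  then show ?thesis
    by (simp add: pd_add differentiable_christoffel_low assms)
qed

text \<open>Adding the two sides of \<open>riem_eq_low\<close> for \<open>k l\<close> and
  \<open>l k\<close> leaves a commutator of second derivatives of \<open>G\<close>, which is 0,
  while the quadratic terms cancel by \<open>christoffel_low_pairing\<close>.\<close>

lemma riem_antisym_last:
  assumes "x \<in> S"
  shows "riem G x i j k l = - riem G x i j l k"
  using pd_christoffel_low_sym[OF assms, of i k j l] pd_christoffel_low_sym[OF assms, of j k i l]
    pd_commute[OF open_S assms Ck2, of i j k l]
    christoffel_low_pairing[OF assms, of i k j l] christoffel_low_pairing[OF assms, of j k i l]
  unfolding riem_eq_low[OF assms] by linarith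

end

lemma riem_antisym_first: "riem G x i j k l = - riem G x j i k l"
  unfolding riem_def curv_endo_def
  by (simp add: sum_negf[symmetric] sum_subtractf algebra_simps)

section \<open>Contraction over orthonormal frames\<close>

lemma sum_rotate3:
  "(\<Sum>i\<in>I. \<Sum>j\<in>J. \<Sum>a\<in>A. f i j a) = (\<Sum>a\<in>A. \<Sum>i\<in>I. \<Sum>j\<in>J. f i j a)"
proof -
  have "(\<Sum>i\<in>I. \<Sum>j\<in>J. \<Sum>a\<in>A. f i j a) = (\<Sum>i\<in>I. \<Sum>a\<in>A. \<Sum>j\<in>J. f i j a)"
    by (intro sum.cong refl sum.swap)
  also have "\<dots> = (\<Sum>a\<in>A. \<Sum>i\<in>I. \<Sum>j\<in>J. f i j a)"
    by (rule sum.swap)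
  finally show ?thesis .
qed

lemma sum_rotate5:
  "(\<Sum>i\<in>I. \<Sum>j\<in>J. \<Sum>k\<in>K. \<Sum>l\<in>L. \<Sum>a\<in>A. f i j k l a) =
   (\<Sum>a\<in>A. \<Sum>i\<in>I. \<Sum>j\<in>J. \<Sum>k\<in>K. \<Sum>l\<in>L. f i j k l a)"
proof -
  have "(\<Sum>i\<in>I. \<Sum>j\<in>J. \<Sum>k\<in>K. \<Sum>l\<in>L. \<Sum>a\<in>A. f i j k l a) =
      (\<Sum>i\<in>I. \<Sum>j\<in>J. \<Sum>a\<in>A. \<Sum>k\<in>K. \<Sum>l\<in>L. f i j k l a)"
    by (intro sum.cong refl sum_rotate3)
  also have "\<dots> = (\<Sum>a\<in>A. \<Sum>i\<in>I. \<Sum>j\<in>J. \<Sum>k\<in>K. \<Sum>l\<in>L. f i j k l a)"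
    by (rule sum_rotate3)
  finally show ?thesis .
qed

text \<open>Used twice: with weights 1 for the inverse metric, giving the scalar curvature, and with
  the eigenvalues of \<open>h\<close> for the raised tensor.\<close>

lemma contract_eq_riem_vec:
  fixes e :: "'n \<Rightarrow> real^'n::finite"
  assumes "\<And>i k. M i k = (\<Sum>a\<in>UNIV. l a * (e a $ i * e a $ k))"
  shows "(\<Sum>i\<in>UNIV. \<Sum>j\<in>UNIV. \<Sum>k\<in>UNIV. \<Sum>l\<in>UNIV. riem G x i j k l * M i k * M j l) =
    (\<Sum>a\<in>UNIV. \<Sum>b\<in>UNIV. riem_vec G x (e a) (e b) (e a) (e b) * (l a * l b))"
proof -
  have "(\<Sum>i\<in>UNIV. \<Sum>j\<in>UNIV. \<Sum>k\<in>UNIV. \<Sum>l\<in>UNIV. riem G x i j k l * M i k * M j l) =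
      (\<Sum>i\<in>UNIV. \<Sum>j\<in>UNIV. \<Sum>k\<in>UNIV. \<Sum>m\<in>UNIV. \<Sum>a\<in>UNIV. \<Sum>b\<in>UNIV.
        riem G x i j k m * e a $ i * e b $ j * e a $ k * e b $ m * (l a * l b))"
    unfolding assms mult.assoc sum_product by (simp add: sum_distrib_left mult_ac)
  also have "\<dots> = (\<Sum>a\<in>UNIV. \<Sum>b\<in>UNIV. \<Sum>i\<in>UNIV. \<Sum>j\<in>UNIV. \<Sum>k\<in>UNIV. \<Sum>m\<in>UNIV.
        riem G x i j k m * e a $ i * e b $ j * e a $ k * e b $ m * (l a * l b))"
    by (subst sum_rotate5) (intro sum.cong refl sum_rotate5)
  finally show ?thesis
    by (simp add: riem_vec_def sum_distrib_right)
qed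

text \<open>The columns of \<open>W\<close> are the frame, so orthonormality says
  \<open>transpose W ** A ** W = mat 1\<close>. For square matrices a one-sided inverse is
  two-sided, which lets the factors move around.\<close>

lemma orthonormal_frame_matrix:
  fixes A :: "real^'n^'n::finite" and e :: "'n \<Rightarrow> real^'n"
  assumes "\<And>a b. bform A (e a) (e b) = (if a = b then 1 else 0)"
  defines "W \<equiv> \<chi> i a. e a $ i"
  shows "(A ** W) ** transpose W = mat 1" "W ** (transpose W ** A) = mat 1"
proof -
  have "(transpose W ** (A ** W)) $ a $ b = bform A (e a) (e b)" for a b
    unfolding bform_eq_sum W_def
    by (simp add: matrix_matrix_mult_def transpose_def sum_distrib_left mult_ac)
  then have "transpose W ** (A ** W) = mat 1"
    by (simp add: assms(1) vec_eq_iff mat_def)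
  then show "(A ** W) ** transpose W = mat 1"
    by (simp add: matrix_left_right_inverse)
  have "(transpose W ** A) ** W = mat 1"
    using \<open>transpose W ** (A ** W) = mat 1\<close> by (simp add: matrix_mul_assoc)
  then show "W ** (transpose W ** A) = mat 1"
    by (simp add: matrix_left_right_inverse)
qed

lemma matrix_inv_orthonormal_frame:
  fixes A :: "real^'n^'n::finite" and e :: "'n \<Rightarrow> real^'n"
  assumes "\<And>a b. bform A (e a) (e b) = (if a = b then 1 else 0)"
  shows "matrix_inv A $ i $ k = (\<Sum>a\<in>UNIV. e a $ i * e a $ k)"
proof -
  let ?W = "(\<chi> i a. e a $ i) :: real^'n^'n"
  have "matrix_inv A = ?W ** transpose ?W"
    using orthonormal_frame_matrix(1)[OF assms] by (intro matrix_inv_eqI) (simp add: matrix_mul_assoc)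
  then show ?thesis
    by (simp add: matrix_matrix_mult_def transpose_def)
qed

text \<open>A tensor is recovered from its frame components: \<open>H\<close> equals
  \<open>transpose W ** H ** W\<close> multiplied on both sides by the inverses supplied by
  \<open>orthonormal_frame_matrix\<close>.\<close>

lemma bform_frame_zero_imp:
  fixes A H :: "real^'n^'n::finite" and e :: "'n \<Rightarrow> real^'n"
  assumes "\<And>a b. bform A (e a) (e b) = (if a = b then 1 else 0)"
    and "\<And>a b. bform H (e a) (e b) = 0"
  shows "H = 0"
proof -
  let ?W = "(\<chi> i a. e a $ i) :: real^'n^'n"
  have "(transpose ?W ** H ** ?W) $ a $ b = bform H (e a) (e b)" for a b
    unfolding bform_eq_sum
    by (simp add: matrix_matrix_mult_def transpose_def sum_distrib_left mult_ac) (rule sum.swap)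
  then have 0: "transpose ?W ** H ** ?W = 0"
    by (simp add: assms(2) vec_eq_iff)
  have "H = ((A ** ?W) ** transpose ?W) ** H ** (?W ** (transpose ?W ** A))"
    using orthonormal_frame_matrix[OF assms(1)] by simp
  also have "\<dots> = (A ** ?W) ** (transpose ?W ** H ** ?W) ** (transpose ?W ** A)"
    by (simp add: matrix_mul_assoc)
  finally show ?thesis
    unfolding 0 by (simp add: matrix_matrix_mult_def vec_eq_iff)
qed

section \<open>The eigenvalue inequality\<close>

text \<open>Right side minus left side is the sum of \<open>K a b * q a b\<close>, which is positive
  by a weighted sum over triples of distinct indices.\<close>

lemma pinched_sum_pos:
  fixes K :: "'n::finite \<Rightarrow> 'n \<Rightarrow> real" and l :: "'n \<Rightarrow> real"
  assumes card: "CARD('n) \<ge> 4"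
    and sym: "\<And>a b. K a b = K b a" and diag: "\<And>a. K a a = 0"
    and pos: "\<And>a b c. a \<noteq> b \<Longrightarrow> a \<noteq> c \<Longrightarrow> b \<noteq> c \<Longrightarrow> K a c + K b c > 0"
    and "l z \<noteq> 0"
  shows "2 * (\<Sum>a\<in>UNIV. \<Sum>b\<in>UNIV. K a b * (l a * l b)) < (\<Sum>a\<in>UNIV. \<Sum>b\<in>UNIV. K a b) * (\<Sum>a\<in>UNIV. (l a)\<^sup>2)"
proof -
  define N where "N = (\<Sum>a\<in>UNIV. (l a)\<^sup>2)"
  define q where "q a b = N - 2 * (l a * l b)" for a b
  define D where "D = {(a, b, c). a \<noteq> b \<and> a \<noteq> c \<and> b \<noteq> (c::'n)}"
  define F where "F = (\<lambda>(a, b, c). (K a c + K b c) * (q a c + q b c - q a b))"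
  have q_ge: "q a c + q b c - q a b \<ge> (\<Sum>d\<in>-{a, b, c}. (l d)\<^sup>2)"
    if "a \<noteq> b" "a \<noteq> c" "b \<noteq> c" for a b c
  proof -
    have "N = (\<Sum>d\<in>{a, b, c}. (l d)\<^sup>2) + (\<Sum>d\<in>-{a, b, c}. (l d)\<^sup>2)"
      unfolding N_def by (subst sum.union_disjoint[symmetric]) (auto intro: sum.cong)
    moreover have "(\<Sum>d\<in>{a, b, c}. (l d)\<^sup>2) = (l a)\<^sup>2 + (l b)\<^sup>2 + (l c)\<^sup>2"
      using that by simp
    moreover have "(l a + l b - l c)\<^sup>2 \<ge> 0" by simp
    ultimately show ?thesis
      by (simp add: q_def power2_eq_square algebra_simps)
  qed
  have F_nonneg: "F t \<ge> 0" if tD: "t \<in> D" for t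
  proof -
    obtain a b c where abc: "t = (a, b, c)" "a \<noteq> b" "a \<noteq> c" "b \<noteq> c"
      using tD by (auto simp: D_def)
    have "0 \<le> (\<Sum>d\<in>-{a, b, c}. (l d)\<^sup>2)" by (simp add: sum_nonneg)
    with q_ge[OF abc(2-4)] pos[OF abc(2-4)] show ?thesis
      by (simp add: F_def abc(1))
  qed
  \<comment> \<open>With four indices available, a triple can avoid \<open>z\<close>; then
    \<open>l z\<close> enters the remainder in \<open>q_ge\<close> and makes one summand strictly
    positive.\<close>
  have "3 \<le> card (-{z})"
    using card by (simp add: Compl_eq_Diff_UNIV card_Diff_subset)
  then obtain X where "X \<subseteq> -{z}" "card X = 3"
    using obtain_subset_with_card_n by metis
  then obtain a b c where abc: "a \<noteq> b" "a \<noteq> c" "b \<noteq> c" "z \<in> - {a, b, c}"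
    by (auto simp: card_3_iff)
  have "(l z)\<^sup>2 \<le> (\<Sum>d\<in>-{a, b, c}. (l d)\<^sup>2)"
    using abc by (intro member_le_sum) auto
  with \<open>l z \<noteq> 0\<close> have "0 < (\<Sum>d\<in>-{a, b, c}. (l d)\<^sup>2)"
    by (smt (verit) zero_less_power2)
  with q_ge[OF abc(1-3)] pos[OF abc(1-3)] have "F (a, b, c) > 0"
    by (simp add: F_def)
  then have "0 < (\<Sum>t\<in>D. F t)"
    using abc F_nonneg by (intro sum_pos2[of _ "(a, b, c)"]) (auto simp: D_def)
  also have "(\<Sum>t\<in>D. F t) = 2 * (real CARD('n) - 2) * (\<Sum>a\<in>UNIV. \<Sum>b\<in>UNIV. K a b * q a b)"
  proof -
    have q_sym: "q a b = q b a" for a b by (simp add: q_def mult.commute)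
    \<comment> \<open>Each pair \<open>a\<close>, \<open>c\<close> of distinct indices extends to a
      triple in \<open>n - 2\<close> ways; \<open>diag\<close> then permits summing over all
      pairs.\<close>
    have ac: "(\<Sum>(a, b, c)\<in>D. K a c * q a c) = (real CARD('n) - 2) * (\<Sum>a\<in>UNIV. \<Sum>b\<in>UNIV. K a b * q a b)"
    proof -
      have "(\<Sum>(a, b, c)\<in>D. K a c * q a c) =
          (\<Sum>(a, c, b)\<in>(SIGMA a:UNIV. SIGMA c:-{a}. -{a, c}). K a c * q a c)"
        by (rule sum.reindex_bij_witness[of _ "\<lambda>(a, c, b). (a, b, c)" "\<lambda>(a, b, c). (a, c, b)"])
          (auto simp: D_def)
      also have "\<dots> = (\<Sum>a\<in>UNIV. \<Sum>(c, b)\<in>(SIGMA c:-{a}. -{a, c}). K a c * q a c)"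
        by (subst sum.Sigma) auto
      also have "\<dots> = (\<Sum>a\<in>UNIV. \<Sum>c\<in>-{a}. \<Sum>b\<in>-{a, c}. K a c * q a c)"
        by (intro sum.cong refl, subst sum.Sigma) auto
      also have "\<dots> = (\<Sum>a\<in>UNIV. \<Sum>c\<in>-{a}. (real CARD('n) - 2) * (K a c * q a c))"
        using card by (intro sum.cong refl) (simp add: Compl_eq_Diff_UNIV card_Diff_subset)
      also have "\<dots> = (\<Sum>a\<in>UNIV. \<Sum>c\<in>UNIV. (real CARD('n) - 2) * (K a c * q a c))"
        by (intro sum.cong refl sum.mono_neutral_left) (auto simp: diag)
      finally show ?thesis by (simp add: sum_distrib_left)
    qed
    have bc: "(\<Sum>(a, b, c)\<in>D. K b c * q b c) = (\<Sum>(a, b, c)\<in>D. K a c * q a c)"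
      by (rule sum.reindex_bij_witness[of _ "\<lambda>(a, b, c). (b, a, c)" "\<lambda>(a, b, c). (b, a, c)"])
        (auto simp: D_def)
    \<comment> \<open>Exchanging \<open>a\<close> and \<open>c\<close> fixes \<open>K a c\<close>
      and turns \<open>q b c\<close> into \<open>q a b\<close>, so the mixed terms cancel in the sum
      of \<open>F\<close>.\<close>
    have c1: "(\<Sum>(a, b, c)\<in>D. K a c * q b c) = (\<Sum>(a, b, c)\<in>D. K a c * q a b)"
      by (rule sum.reindex_bij_witness[of _ "\<lambda>(a, b, c). (c, b, a)" "\<lambda>(a, b, c). (c, b, a)"])
        (auto simp: D_def sym q_sym)
    have c2: "(\<Sum>(a, b, c)\<in>D. K b c * q a c) = (\<Sum>(a, b, c)\<in>D. K b c * q a b)"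
      by (rule sum.reindex_bij_witness[of _ "\<lambda>(a, b, c). (a, c, b)" "\<lambda>(a, b, c). (a, c, b)"])
        (auto simp: D_def sym q_sym)
    have "(\<Sum>t\<in>D. F t) =
        (\<Sum>(a, b, c)\<in>D. K a c * q a c) + (\<Sum>(a, b, c)\<in>D. K b c * q b c)
      + ((\<Sum>(a, b, c)\<in>D. K a c * q b c) - (\<Sum>(a, b, c)\<in>D. K a c * q a b))
      + ((\<Sum>(a, b, c)\<in>D. K b c * q a c) - (\<Sum>(a, b, c)\<in>D. K b c * q a b))"
      unfolding sum.distrib[symmetric] sum_subtractf[symmetric]
      by (intro sum.cong refl) (auto simp: F_def algebra_simps)
    then show ?thesis unfolding bc c1 c2 ac by simp
  qed
  finally have "(\<Sum>a\<in>UNIV. \<Sum>b\<in>UNIV. K a b * q a b) > 0"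
    using card by (simp add: zero_less_mult_iff)
  also have "(\<Sum>a\<in>UNIV. \<Sum>b\<in>UNIV. K a b * q a b) = (\<Sum>a\<in>UNIV. \<Sum>b\<in>UNIV. K a b) * N - 2 * (\<Sum>a\<in>UNIV. \<Sum>b\<in>UNIV. K a b * (l a * l b))"
    by (simp add: q_def right_diff_distrib sum_subtractf sum_distrib_left sum_distrib_right mult_ac)
  finally show ?thesis by (simp add: N_def)
qed

section \<open>Attainment of the supremum\<close>

text \<open>Numerator and denominator of the quotient in \<open>curv_sup\<close> get names of their
  own, since continuity and scaling are proved for each separately.\<close>

definition curv_num :: "(real^'n \<Rightarrow> real^'n^'n) \<Rightarrow> real^'n::finite \<Rightarrow> real^'n^'n \<Rightarrow> real" where
  "curv_num G x h = (\<Sum>i\<in>UNIV. \<Sum>j\<in>UNIV. \<Sum>k\<in>UNIV. \<Sum>l\<in>UNIV.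
     riem G x i j k l * raise G x h $ i $ k * raise G x h $ j $ l)"

definition tensor_sqnorm :: "(real^'n \<Rightarrow> real^'n^'n) \<Rightarrow> real^'n::finite \<Rightarrow> real^'n^'n \<Rightarrow> real" where
  "tensor_sqnorm G x h = (\<Sum>i\<in>UNIV. \<Sum>k\<in>UNIV. h $ i $ k * raise G x h $ i $ k)"

lemma curv_sup_eq: "curv_sup G x = (SUP h\<in>{h. transpose h = h \<and> h \<noteq> 0}. curv_num G x h / tensor_sqnorm G x h)"
  by (simp add: curv_sup_def curv_num_def tensor_sqnorm_def)

lemma raise_scaleR: "raise G x (c *\<^sub>R h) = c *\<^sub>R raise G x h"
  by (simp add: raise_def vec_eq_iff sum_distrib_left mult_ac)

lemma curv_num_scaleR: "curv_num G x (c *\<^sub>R h) = c\<^sup>2 * curv_num G x h"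
  by (simp add: curv_num_def raise_scaleR sum_distrib_left power2_eq_square mult_ac)

lemma tensor_sqnorm_scaleR: "tensor_sqnorm G x (c *\<^sub>R h) = c\<^sup>2 * tensor_sqnorm G x h"
  by (simp add: tensor_sqnorm_def raise_scaleR sum_distrib_left power2_eq_square mult_ac)

lemma continuous_on_curv_num: "continuous_on T (curv_num G x)"
  unfolding curv_num_def[abs_def] raise_def by simp (intro continuous_intros)

lemma continuous_on_tensor_sqnorm: "continuous_on T (tensor_sqnorm G x)"
  unfolding tensor_sqnorm_def[abs_def] raise_def by simp (intro continuous_intros)

text \<open>Numerator and denominator both scale quadratically, so a maximizer on the compact unit
  sphere of symmetric matrices bounds the quotient everywhere. An upper bound is enough for the
  later strict inequality.\<close>

lemma curv_sup_attained:
  fixes G :: "real^'n \<Rightarrow> real^'n^'n::finite"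
  assumes pos: "\<And>h. transpose h = h \<Longrightarrow> h \<noteq> 0 \<Longrightarrow> tensor_sqnorm G x h > 0"
  obtains h where "transpose h = h" "h \<noteq> 0" "curv_sup G x \<le> curv_num G x h / tensor_sqnorm G x h"
proof -
  let ?S = "{h :: real^'n^'n. transpose h = h}" and ?q = "\<lambda>h. curv_num G x h / tensor_sqnorm G x h"
  have "?S = {h. \<forall>i j. h $ j $ i = h $ i $ j}"
    by (auto simp: vec_eq_iff transpose_def)
  moreover have "closed {h :: real^'n^'n. \<forall>i j. h $ j $ i = h $ i $ j}"
    by (intro closed_Collect_all closed_Collect_eq continuous_intros)
  ultimately have compact: "compact (?S \<inter> sphere 0 1)"
    by (simp add: closed_Int_compact)
  have unit: "h /\<^sub>R norm h \<in> ?S \<inter> sphere 0 1" if "transpose h = h" "h \<noteq> 0" for h :: "real^'n^'n"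
    using that by (simp add: transpose_scalar)
  \<comment> \<open>The identity matrix shows that the index set of the supremum is
    nonempty.\<close>
  have one: "transpose (mat 1) = (mat 1 :: real^'n^'n)" "(mat 1 :: real^'n^'n) \<noteq> 0"
    by (simp, simp add: vec_eq_iff mat_def)
  have cont: "continuous_on (?S \<inter> sphere 0 1) ?q"
  proof (intro continuous_on_divide continuous_on_curv_num continuous_on_tensor_sqnorm ballI)
    show "tensor_sqnorm G x h \<noteq> 0" if "h \<in> ?S \<inter> sphere 0 1" for h
      using pos[of h] that by force
  qed
  have "?S \<inter> sphere 0 1 \<noteq> {}"
    using unit[OF one] by blast
  from continuous_attains_sup[OF compact this cont]
  obtain h where h: "h \<in> ?S \<inter> sphere 0 1" and max: "\<And>k. k \<in> ?S \<inter> sphere 0 1 \<Longrightarrow> ?q k \<le> ?q h"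
    by blast
  have "?q k \<le> ?q h" if "transpose k = k" "k \<noteq> 0" for k
    using max[OF unit[OF that]] that(2) by (simp add: curv_num_scaleR tensor_sqnorm_scaleR)
  then have "curv_sup G x \<le> ?q h"
    unfolding curv_sup_eq using one by (intro cSUP_least) blast+
  moreover have "transpose h = h" "h \<noteq> 0"
    using h by auto
  ultimately show thesis using that by blast
qed

section \<open>From frames to the pointwise inequality\<close>

context local_metric
begin

lemma riem_vec_antisym:
  assumes "x \<in> S"
  shows "riem_vec G x u v w z = - riem_vec G x v u w z" "riem_vec G x u v w z = - riem_vec G x u v z w"
proof -
  have "riem_vec G x u v w z = (\<Sum>j\<in>UNIV. \<Sum>i\<in>UNIV. \<Sum>k\<in>UNIV. \<Sum>l\<in>UNIV. riem G x i j k l * u $ i * v $ j * w $ k * z $ l)"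
    unfolding riem_vec_def by (rule sum.swap)
  also have "\<dots> = - riem_vec G x v u w z"
    unfolding riem_vec_def sum_negf[symmetric] by (subst riem_antisym_first) (simp add: mult_ac)
  finally show "riem_vec G x u v w z = - riem_vec G x v u w z" .
  have "riem_vec G x u v w z = (\<Sum>i\<in>UNIV. \<Sum>j\<in>UNIV. \<Sum>l\<in>UNIV. \<Sum>k\<in>UNIV. riem G x i j k l * u $ i * v $ j * w $ k * z $ l)"
    unfolding riem_vec_def by (intro sum.cong refl sum.swap)
  also have "\<dots> = - riem_vec G x u v z w"
    unfolding riem_vec_def sum_negf[symmetric] by (subst riem_antisym_last[OF assms]) (simp add: mult_ac)
  finally show "riem_vec G x u v w z = - riem_vec G x u v z w" .
qed

text \<open>Brings numerator, squared norm and scalar curvature into the shape that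
  \<open>pinched_sum_pos\<close> expects, all in one frame adapted to \<open>h\<close>.\<close>

lemma diagonalizing_frame:
  assumes "x \<in> S" "transpose h = h" "h \<noteq> 0"
  obtains e :: "'n \<Rightarrow> real^'n" and l z where
    "\<And>a b. metric_inner G x (e a) (e b) = (if a = b then 1 else 0)"
    "curv_num G x h = (\<Sum>a\<in>UNIV. \<Sum>b\<in>UNIV. riem_vec G x (e a) (e b) (e a) (e b) * (l a * l b))"
    "tensor_sqnorm G x h = (\<Sum>a\<in>UNIV. (l a)\<^sup>2)"
    "scalar_curv G x = (\<Sum>a\<in>UNIV. \<Sum>b\<in>UNIV. riem_vec G x (e a) (e b) (e a) (e b))"
    "l z \<noteq> 0"
proof -
  obtain e :: "'n \<Rightarrow> real^'n" and l where
    orth: "\<And>a b. bform (G x) (e a) (e b) = (if a = b then 1 else 0)" and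
    diag: "\<And>a b. bform h (e a) (e b) = (if a = b then l a else 0)"
    using simultaneous_diagonalization[OF transpose_G[OF assms(1)] assms(2) bform_pos[OF assms(1)]] by blast
  have inv: "metric_inv G x $ i $ k = (\<Sum>a\<in>UNIV. e a $ i * e a $ k)" for i k
    by (simp add: metric_inv_def matrix_inv_orthonormal_frame[OF orth])
  \<comment> \<open>The inverse metric is the sum of the squares of the frame vectors, so raising
    both indices of \<open>h\<close> yields its spectral decomposition.\<close>
  have raise: "raise G x h $ i $ k = (\<Sum>a\<in>UNIV. l a * (e a $ i * e a $ k))" for i k
  proof -
    have "raise G x h $ i $ k = (\<Sum>p\<in>UNIV. \<Sum>q\<in>UNIV. \<Sum>a\<in>UNIV. \<Sum>b\<in>UNIV. 
        h $ p $ q * e a $ p * e b $ q * (e a $ i * e b $ k))"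
      unfolding raise_def inv unfolding sum_product unfolding sum_distrib_right by (simp add: mult_ac)
    also have "\<dots> = (\<Sum>a\<in>UNIV. \<Sum>b\<in>UNIV. \<Sum>p\<in>UNIV. \<Sum>q\<in>UNIV.
        h $ p $ q * e a $ p * e b $ q * (e a $ i * e b $ k))"
      by (subst sum_rotate3) (intro sum.cong refl sum_rotate3)
    also have "\<dots> = (\<Sum>a\<in>UNIV. \<Sum>b\<in>UNIV. bform h (e a) (e b) * (e a $ i * e b $ k))"
      by (simp add: bform_eq_sum sum_distrib_right)
    also have "\<dots> = (\<Sum>a\<in>UNIV. l a * (e a $ i * e a $ k))"
      by (simp add: diag if_distribR if_distrib cong: if_cong)
    finally show ?thesis .
  qed
  have "tensor_sqnorm G x h = (\<Sum>i\<in>UNIV. \<Sum>k\<in>UNIV. \<Sum>a\<in>UNIV. l a * (h $ i $ k * e a $ i * e a $ k))"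
    unfolding tensor_sqnorm_def raise by (simp add: sum_distrib_left mult_ac)
  also have "\<dots> = (\<Sum>a\<in>UNIV. l a * bform h (e a) (e a))"
    unfolding bform_eq_sum sum_distrib_left by (rule sum_rotate3)
  finally have norm: "tensor_sqnorm G x h = (\<Sum>a\<in>UNIV. (l a)\<^sup>2)"
    by (simp add: diag power2_eq_square)
  have scal: "scalar_curv G x = (\<Sum>a\<in>UNIV. \<Sum>b\<in>UNIV. riem_vec G x (e a) (e b) (e a) (e b))"
    using contract_eq_riem_vec[of "\<lambda>i k. metric_inv G x $ i $ k" "\<lambda>a. 1" e G x] inv
    by (simp add: scalar_curv_def mult_ac)
  \<comment> \<open>If all eigenvalues vanished, every frame component of \<open>h\<close> would be
    0, and hence \<open>h\<close> itself.\<close>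
  obtain z where "l z \<noteq> 0"
  proof (rule ccontr)
    assume "\<not> thesis"
    then have "l a = 0" for a using that by blast
    then have "h = 0"
      using orth by (intro bform_frame_zero_imp[of "G x" e h]) (simp_all add: diag)
    with assms(3) show False ..
  qed
  then show thesis
    using that[OF _ _ norm scal] orth contract_eq_riem_vec[of "\<lambda>i k. raise G x h $ i $ k" l e G x] raise
    by (simp add: metric_inner_eq_bform curv_num_def)
qed

text \<open>The strict bound for each single \<open>h\<close> is applied to one whose quotient
  dominates the supremum.\<close>

lemma curv_sup_less:
  assumes "x \<in> S" and card: "CARD('n) \<ge> 4"
    and pic: "\<And>u v w. orthonormal3 G x u v w \<Longrightarrow> riem_vec G x u w u w + riem_vec G x v w v w > 0"
  shows "2 * curv_sup G x < scalar_curv G x"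
proof -
  have sqnorm_pos: "tensor_sqnorm G x h > 0" and less: "2 * curv_num G x h < scalar_curv G x * tensor_sqnorm G x h"
    if h: "transpose h = h" "h \<noteq> 0" for h
  proof -
    obtain e :: "'n \<Rightarrow> real^'n" and l z where
      orth: "\<And>a b. metric_inner G x (e a) (e b) = (if a = b then 1 else 0)"
      and num: "curv_num G x h = (\<Sum>a\<in>UNIV. \<Sum>b\<in>UNIV. riem_vec G x (e a) (e b) (e a) (e b) * (l a * l b))"
      and norm: "tensor_sqnorm G x h = (\<Sum>a\<in>UNIV. (l a)\<^sup>2)"
      and scal: "scalar_curv G x = (\<Sum>a\<in>UNIV. \<Sum>b\<in>UNIV. riem_vec G x (e a) (e b) (e a) (e b))"
      and z: "l z \<noteq> 0"
      using diagonalizing_frame[OF assms(1) h] by blast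
    show "tensor_sqnorm G x h > 0"
      unfolding norm using z by (intro sum_pos2[of _ z]) auto
    show "2 * curv_num G x h < scalar_curv G x * tensor_sqnorm G x h"
      unfolding num norm scal
    proof (rule pinched_sum_pos[OF card])
      \<comment> \<open>Exchanging the vectors in both index pairs changes the sign twice, so the
        two antisymmetries suffice.\<close>
      show "riem_vec G x (e a) (e b) (e a) (e b) = riem_vec G x (e b) (e a) (e b) (e a)" for a b
        using riem_vec_antisym[OF assms(1)] by metis
      show "riem_vec G x (e a) (e a) (e a) (e a) = 0" for a
        using riem_vec_antisym(1)[OF assms(1), of "e a" "e a" "e a" "e a"] by simp
      show "riem_vec G x (e a) (e c) (e a) (e c) + riem_vec G x (e b) (e c) (e b) (e c) > 0"
        if "a \<noteq> b" "a \<noteq> c" "b \<noteq> c" for a b c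
        using that by (intro pic) (simp add: orthonormal3_def orth)
    qed (rule z)
  qed
  obtain h where h: "transpose h = h" "h \<noteq> 0" "curv_sup G x \<le> curv_num G x h / tensor_sqnorm G x h"
    using curv_sup_attained sqnorm_pos by blast
  have "2 * (curv_num G x h / tensor_sqnorm G x h) < scalar_curv G x"
    using less[OF h(1,2)] sqnorm_pos[OF h(1,2)] by (simp add: field_simps)
  then show ?thesis using h(3) by linarith
qed

end

theorem proposition1p6:
  fixes M :: "'a topology"
    and A :: "('a, 'n::finite) chart set"
    and g :: "('a, 'n) chart \<Rightarrow> real^'n \<Rightarrow> real^'n^'n"
  assumes "riemannian_manifold M A g"
    and "CARD('n) \<ge> 4"
    and "PIC0 M A g"
  shows "\<forall>p\<in>topspace M. \<forall>c\<in>A. p \<in> fst c \<longrightarrow>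
           2 * curv_sup (g c) (snd c p) < scalar_curv (g c) (snd c p)"
proof (intro ballI impI)
  fix p c assume p: "p \<in> topspace M" and c: "c \<in> A" "p \<in> fst c"
  have "is_chart M c" and metric: "riemannian_metric A g"
    using assms(1) c(1) by (auto simp: riemannian_manifold_def smooth_manifold_def)
  \<comment> \<open>All quantities in the claim are expressed in the chart \<open>c\<close>, so the
    metric components on its image suffice.\<close>
  interpret local_metric "g c" "snd c ` fst c"
  proof
    show "open (snd c ` fst c)"
      using \<open>is_chart M c\<close> by (simp add: is_chart_def)
  qed (use metric c(1) in \<open>auto simp: riemannian_metric_def smooth_on_def\<close>)
  show "2 * curv_sup (g c) (snd c p) < scalar_curv (g c) (snd c p)"
    using assms(2,3) p c by (intro curv_sup_less) (auto simp: PIC0_def)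
qed

end
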